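(* Let $d=1$ and let $Q$ be a probability measure on $\Omega=\{0,1\}^{\mathbb{Z}}$ such that (1) $Q$ is stationary and ergodic with respect to the shift $\theta_{1}$, and (2) $Q(\mathcal{P}(\omega)=\emptyset)<1$. Then the random walk $(X_n)_{n\ge0}$ on the discrete point process is $\mathbb{P}$-almost surely recurrent, where $\mathbb{P}$ is the annealed law.
   Context: Setting (with $d=1$). $\Omega=\{0,1\}^{\mathbb{Z}}$ carries its product Borel $\sigma$-algebra. For $x\in\mathbb{Z}$, $(\theta_x\omega)(y)=\omega(x+y)$. $\mathcal{P}(\omega)=\{x\in\mathbb{Z}:\omega(x)=1\}$. $\Omega_0=\{\omega:\omega(0)=1\}$; under (1),(2) one has $Q(\Omega_0)>0$, and $P(\cdot)=Q(\cdot\mid\Omega_0)$. For $e\in\{1,-1\}$, $f_e(\omega)=\min\{k>0:\omega(ke)=1\}$ (for $Q$-a.e. $\omega$, $f_e(\theta_v\omega)<\infty$ for all $v$ and $e$). The coordinate nearest neighbors of $v$ are $N_v(\omega)=\{v+f_1(\theta_v\omega),\,v-f_{-1}(\theta_v\omega)\}$. For $P$-a.e. $\omega\in\Omega_0$, $P_\omega$ (quenched law) is the law of the Markov chain $(X_n)_{n\ge0}$ on $\mathcal{P}(\omega)$ with $P_\omega(X_0=0)=1$ and $P_\omega(X_{n+1}=u\mid X_n=v)=\frac12$ if $u\in N_v(\omega)$ and $0$ otherwise. The annealed law is $\mathbb{P}(G)=\int P_\omega(G)\,P(d\omega)$. Recurrent means that $X_n=0$ for infinitely many $n$. *)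

theory Defs
  imports "HOL-Probability.Probability"
begin

text \<open>Configurations in \<open>{0,1}\<^sup>\<int>\<close> are rendered as \<open>int \<Rightarrow> bool\<close>, with \<open>True\<close> for the value 1.\<close>

type_synonym config = "int \<Rightarrow> bool"

definition config_space :: "config measure" where
  "config_space = (\<Pi>\<^sub>M x\<in>UNIV. count_space (UNIV :: bool set))"

definition translate :: "int \<Rightarrow> config \<Rightarrow> config" where
  "translate x \<omega> = (\<lambda>y. \<omega> (x + y))"

definition points :: "config \<Rightarrow> int set" where
  "points \<omega> = {x. \<omega> x}"

definition stationary :: "'a measure \<Rightarrow> ('a \<Rightarrow> 'a) \<Rightarrow> bool" where
  "stationary M T \<longleftrightarrow> T \<in> M \<rightarrow>\<^sub>M M \<and> distr M M T = M"

definition ergodic :: "'a measure \<Rightarrow> ('a \<Rightarrow> 'a) \<Rightarrow> bool" where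
  "ergodic M T \<longleftrightarrow> stationary M T \<and>
     (\<forall>A\<in>sets M. T -` A \<inter> space M = A \<longrightarrow> measure M A = 0 \<or> measure M A = 1)"

definition Omega0 :: "config set" where
  "Omega0 = {\<omega>. \<omega> 0}"

definition palm :: "config measure \<Rightarrow> config measure" where
  "palm Q = uniform_measure Q Omega0"

text \<open>If there is no point in direction \<open>e\<close>, then \<open>first_point e \<omega>\<close> is some unspecified number;
  under the hypotheses of the theorem such configurations (and all their shifts) form a null set.\<close>

definition first_point :: "int \<Rightarrow> config \<Rightarrow> nat" where
  "first_point e \<omega> = (LEAST k. 0 < k \<and> \<omega> (int k * e))"

definition nbrs :: "config \<Rightarrow> int \<Rightarrow> int set" where
  "nbrs \<omega> v = {v + int (first_point 1 (translate v \<omega>)), v - int (first_point (-1) (translate v \<omega>))}"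

definition step_pmf :: "config \<Rightarrow> int \<Rightarrow> int pmf" where
  "step_pmf \<omega> v = pmf_of_set (nbrs \<omega> v)"

lemma pmf_step:
  assumes "\<exists>k>0. \<omega> (v + int k)" "\<exists>k>0. \<omega> (v - int k)"
  shows "pmf (step_pmf \<omega> v) u = (if u \<in> nbrs \<omega> v then 1 / 2 else 0)"
proof -
  have "first_point 1 (translate v \<omega>) > 0"
    using LeastI_ex[OF assms(1)] by (simp add: first_point_def translate_def)
  then have "card (nbrs \<omega> v) = 2"
    by (simp add: nbrs_def)
  then show ?thesis
    by (simp add: step_pmf_def nbrs_def)
qed

text \<open>The walk is realised on the space \<open>nat \<Rightarrow> int\<close> of paths. \<open>walk_kernel \<omega> n x\<close> is the conditional law
  of \<open>X n\<close> given the past \<open>x 0, \<dots>, x (n - 1)\<close>, and \<open>quenched \<omega>\<close> is the path measure obtained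
  from these kernels by the Ionescu-Tulcea theorem.\<close>

definition path_space :: "(nat \<Rightarrow> int) measure" where
  "path_space = (\<Pi>\<^sub>M n\<in>UNIV. count_space (UNIV :: int set))"

definition walk_kernel :: "config \<Rightarrow> nat \<Rightarrow> (nat \<Rightarrow> int) \<Rightarrow> int measure" where
  "walk_kernel \<omega> n x =
     (case n of 0 \<Rightarrow> measure_pmf (return_pmf 0) | Suc m \<Rightarrow> measure_pmf (step_pmf \<omega> (x m)))"

definition quenched :: "config \<Rightarrow> (nat \<Rightarrow> int) measure" where
  "quenched \<omega> = projective_family.lim UNIV
     (Ionescu_Tulcea.CI (walk_kernel \<omega>) (\<lambda>_. count_space UNIV)) (\<lambda>_. count_space UNIV)"

definition annealed :: "config measure \<Rightarrow> (nat \<Rightarrow> int) measure" where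
  "annealed Q = palm Q \<bind> quenched"

lemma Ionescu_Tulcea_walk: "Ionescu_Tulcea (walk_kernel \<omega>) (\<lambda>_. count_space UNIV)"
proof (rule Ionescu_Tulcea.intro)
  fix i :: nat
  let ?M = "PiM {0..<i} (\<lambda>_. count_space (UNIV :: int set))"
  show "walk_kernel \<omega> i \<in> ?M \<rightarrow>\<^sub>M subprob_algebra (count_space UNIV)"
  proof (cases i)
    case 0
    then show ?thesis
      by (auto simp: walk_kernel_def[abs_def] space_subprob_algebra
          intro!: measurable_const prob_space_imp_subprob_space measure_pmf.prob_space_axioms)
  next
    case (Suc m)
    have "(\<lambda>x. x m) \<in> ?M \<rightarrow>\<^sub>M count_space UNIV"
      by (rule measurable_component_singleton) (simp add: Suc)
    moreover have "(\<lambda>v. measure_pmf (step_pmf \<omega> v)) \<in>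
        count_space UNIV \<rightarrow>\<^sub>M subprob_algebra (count_space UNIV)"
      by (auto simp: space_subprob_algebra
          intro!: prob_space_imp_subprob_space measure_pmf.prob_space_axioms)
    ultimately show ?thesis
      unfolding walk_kernel_def[abs_def] Suc by (auto intro: measurable_compose)
  qed
next
  show "prob_space (walk_kernel \<omega> i x)" for i x
    by (auto simp: walk_kernel_def split: nat.split intro: measure_pmf.prob_space_axioms)
qed

lemma sets_quenched [simp]: "sets (quenched \<omega>) = sets path_space"
proof -
  interpret Ionescu_Tulcea "walk_kernel \<omega>" "\<lambda>_. count_space UNIV"
    by (rule Ionescu_Tulcea_walk)
  show ?thesis
    by (simp add: quenched_def path_space_def)
qed

lemma space_quenched [simp]: "space (quenched \<omega>) = UNIV"
  using sets_eq_imp_space_eq[OF sets_quenched] by (simp add: path_space_def space_PiM)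

lemma emeasure_quenched_cylinder_aux:
  "emeasure (quenched \<omega>) {X. \<forall>i<n. X i = x i} =
     (\<Prod>i<n. emeasure (walk_kernel \<omega> i x) {x i})"
proof -
  let ?M = "\<lambda>_::nat. count_space (UNIV :: int set)"
  interpret Ionescu_Tulcea "walk_kernel \<omega>" ?M
    by (rule Ionescu_Tulcea_walk)
  have sing: "{restrict x {0..<n}} = PiE {0..<n} (\<lambda>i. {x i})" for n
    by (auto simp: PiE_iff extensional_def fun_eq_iff)
  have meas [measurable]: "{restrict x {0..<n}} \<in> sets (PiM {0..<n} ?M)" for n
    unfolding sing by (rule sets_PiM_I_finite) auto
  have C: "emeasure (C 0 n (\<lambda>_. undefined)) {restrict x {0..<n}} =
      (\<Prod>i<n. emeasure (walk_kernel \<omega> i x) {x i})" for n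
  proof (induction n)
    case 0
    then show ?case
      using meas[of 0] by (simp add: restrict_def)
  next
    case (Suc n)
    let ?C = "C 0 n (\<lambda>_. undefined)"
    have sp: "(\<lambda>_. undefined) \<in> space (PiM {0..<0} ?M)"
      by (simp add: space_PiM)
    have sets_C': "sets ?C = sets (PiM {0..<n} ?M)"
      using sets_C[OF sp, of n] by simp
    have space_C': "space ?C = space (PiM {0..<n} ?M)"
      using space_C[OF sp, of n] by simp
    have "emeasure (C 0 (Suc n) (\<lambda>_. undefined)) {restrict x {0..<Suc n}} =
        (\<integral>\<^sup>+y. emeasure (eP n y) {restrict x {0..<Suc n}} \<partial>?C)"
      using prob_space.not_empty[OF prob_space_C[OF sp, of n]] measurable_eP[of n]
      by (simp del: restrict_apply)
         (subst emeasure_bind[where N = "PiM {0..<Suc n} ?M"],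
          auto simp: measurable_cong_sets[OF sets_C' refl])
    also have "\<dots> = (\<integral>\<^sup>+y. emeasure (walk_kernel \<omega> n x) {x n} *
        indicator {restrict x {0..<n}} y \<partial>?C)"
    proof (rule nn_integral_cong)
      fix y assume "y \<in> space ?C"
      then have y: "y \<in> space (PiM {0..<n} ?M)"
        by (simp add: space_C')
      have *: "(\<lambda>z. y(n := z)) -` {restrict x {0..<Suc n}} \<inter> space (?M n) =
          (if y = restrict x {0..<n} then {x n} else {})"
      proof -
        have "y(n := z) = restrict x {0..<Suc n} \<longleftrightarrow> z = x n \<and> y = restrict x {0..<n}" for z
        proof
          assume eq: "y(n := z) = restrict x {0..<Suc n}"
          have "y i = restrict x {0..<n} i" for i
            using fun_cong[OF eq, of i] y
            by (cases "i = n") (auto simp: space_PiM PiE_iff extensional_def restrict_def split: if_splits)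
          then show "z = x n \<and> y = restrict x {0..<n}"
            using fun_cong[OF eq, of n] by auto
        qed auto
        then show ?thesis by auto
      qed
      have **: "walk_kernel \<omega> n (restrict x {0..<n}) = walk_kernel \<omega> n x"
        by (auto simp: walk_kernel_def split: nat.split)
      show "emeasure (eP n y) {restrict x {0..<Suc n}} =
          emeasure (walk_kernel \<omega> n x) {x n} * indicator {restrict x {0..<n}} y"
        unfolding emeasure_eP[OF y meas] * by (auto simp: **)
    qed
    also have "\<dots> = emeasure (walk_kernel \<omega> n x) {x n} * emeasure ?C {restrict x {0..<n}}"
      using meas[of n] by (intro nn_integral_cmult_indicator) (simp add: sets_C')
    finally show ?case
      by (simp only: Suc.IH prod.lessThan_Suc mult.commute)
  qed
  have emb: "prod_emb UNIV ?M {0..<n} {restrict x {0..<n}} = {X. \<forall>i<n. X i = x i}"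
    by (auto simp: prod_emb_def space_PiM restrict_def fun_eq_iff split: if_splits)
  have "emeasure (quenched \<omega>) {X. \<forall>i<n. X i = x i} = emeasure (CI {0..<n}) {restrict x {0..<n}}"
    unfolding quenched_def emb[symmetric] by (rule lim[OF _ meas]) simp
  also have "\<dots> = emeasure (C 0 n (\<lambda>_. undefined)) {restrict x {0..<n}}"
    using meas[of n] sets.sets_into_space[OF meas[of n]]
    by (subst emeasure_CI[of _ n]) (auto simp: prod_emb_id space_PiM)
  finally show ?thesis
    by (simp add: C)
qed

theorem emeasure_quenched_cylinder:
  "emeasure (quenched \<omega>) {X. \<forall>i\<le>n. X i = x i} =
     (if x 0 = 0 then \<Prod>i<n. ennreal (pmf (step_pmf \<omega> (x i)) (x (Suc i))) else 0)"
proof -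
  have "{X. \<forall>i\<le>n. X i = x i} = {X. \<forall>i<Suc n. X i = x i}"
    by (auto simp: less_Suc_eq_le)
  then show ?thesis
    unfolding emeasure_quenched_cylinder_aux
    by (simp only: emeasure_quenched_cylinder_aux prod.lessThan_Suc_shift)
       (simp add: walk_kernel_def emeasure_pmf_single pmf_return)
qed

lemma prob_space_quenched: "prob_space (quenched \<omega>)"
  using emeasure_quenched_cylinder_aux[of \<omega> 0] by (intro prob_spaceI) simp

lemma space_config [simp]: "space config_space = UNIV"
  by (simp add: config_space_def space_PiM)

lemma measurable_config_coord [measurable]:
  "(\<lambda>\<omega>. \<omega> x) \<in> config_space \<rightarrow>\<^sub>M count_space UNIV"
  unfolding config_space_def by (rule measurable_component_singleton) simp

lemma measurable_first_point [measurable]: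
  "(\<lambda>\<omega>. first_point e (translate v \<omega>)) \<in> config_space \<rightarrow>\<^sub>M count_space UNIV"
  unfolding first_point_def translate_def by measurable

lemma measurable_pmf_step [measurable]:
  "(\<lambda>\<omega>. pmf (step_pmf \<omega> v) u) \<in> borel_measurable config_space"
proof -
  have "(\<lambda>\<omega>. (\<lambda>a b. pmf (pmf_of_set {v + int a, v - int b}) u)
      (first_point 1 (translate v \<omega>)) (first_point (-1) (translate v \<omega>)))
      \<in> borel_measurable config_space"
    by (rule measurable_compose_countable[OF _ measurable_first_point],
        rule measurable_compose_countable[OF _ measurable_first_point]) simp
  then show ?thesis
    by (simp add: step_pmf_def nbrs_def)
qed

theorem measurable_quenched [measurable]: "quenched \<in> config_space \<rightarrow>\<^sub>M prob_algebra path_space"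
proof -
  define cyl where "cyl xs = {X :: nat \<Rightarrow> int. \<forall>i<length xs. X i = xs ! i}" for xs
  let ?G = "insert {} (range cyl)"
  have "sets path_space = sigma_sets UNIV ?G"
  proof (intro equalityI)
    have "{f. f i \<in> A} \<in> sigma_sets UNIV ?G" for i :: nat and A :: "int set"
    proof -
      have "{f. f i \<in> A} = (\<Union>xs\<in>{xs. length xs = Suc i \<and> xs ! i \<in> A}. cyl xs)" (is "_ = ?R")
      proof (intro equalityI subsetI)
        fix f assume "f \<in> {f. f i \<in> A}"
        then show "f \<in> ?R"
          by (intro UN_I[of "map f [0..<Suc i]"]) (auto simp: cyl_def nth_append less_Suc_eq)
      qed (auto simp: cyl_def)
      also have "\<dots> \<in> sigma_sets UNIV ?G"
        by (rule sigma_sets_UNION) auto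
      finally show ?thesis .
    qed
    then show "sets path_space \<subseteq> sigma_sets UNIV ?G"
      unfolding path_space_def sets_PiM_single
      by (auto intro!: sigma_sets_mono)
    have "cyl xs \<in> sets path_space" for xs
    proof -
      have [measurable]: "(\<lambda>X. X i) \<in> path_space \<rightarrow>\<^sub>M count_space UNIV" for i
        unfolding path_space_def by (rule measurable_component_singleton) simp
      have "{X \<in> space path_space. \<forall>i<length xs. X i = xs ! i} \<in> sets path_space"
        by measurable
      then show ?thesis
        by (simp add: cyl_def path_space_def space_PiM)
    qed
    then show "sigma_sets UNIV ?G \<subseteq> sets path_space"
      using sets.sigma_sets_subset[of ?G path_space]
      by (auto simp: path_space_def space_PiM)
  qed
  moreover have "Int_stable ?G"
  proof (rule Int_stableI)
    fix a b assume ab: "a \<in> ?G" "b \<in> ?G"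
    have *: "cyl xs \<inter> cyl ys = cyl ys \<or> cyl xs \<inter> cyl ys = {}" if "length xs \<le> length ys" for xs ys
    proof (cases "\<forall>i<length xs. xs ! i = ys ! i")
      case True
      with that have "cyl ys \<subseteq> cyl xs" by (auto simp: cyl_def)
      then show ?thesis by blast
    next
      case False
      with that have "cyl xs \<inter> cyl ys = {}" by (auto simp: cyl_def)
      then show ?thesis by blast
    qed
    have "cyl xs \<inter> cyl ys \<in> ?G" for xs ys
      using *[of xs ys] *[of ys xs] by (cases "length xs \<le> length ys") (auto simp: Int_commute)
    with ab show "a \<inter> b \<in> ?G" by auto
  qed
  moreover have "(\<lambda>\<omega>. emeasure (quenched \<omega>) A) \<in> borel_measurable config_space" if "A \<in> ?G" for A
  proof (cases "A = {}")
    case False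
    with that obtain xs where A: "A = cyl xs" by auto
    have k: "(\<lambda>\<omega>. emeasure (walk_kernel \<omega> i (\<lambda>i. xs ! i)) {xs ! i}) \<in> borel_measurable config_space" for i
      by (cases i) (simp_all add: walk_kernel_def emeasure_pmf_single)
    show ?thesis
      unfolding A cyl_def emeasure_quenched_cylinder_aux by (intro borel_measurable_prod_ennreal k)
  qed simp
  ultimately show ?thesis
    by (intro measurable_prob_algebra_generated[where \<Omega> = UNIV and G = ?G])
       (auto intro: prob_space_quenched)
qed

lemma Omega0_nonnull:
  assumes "prob_space Q" and sets_Q: "sets Q = sets config_space"
    and st: "stationary Q (translate 1)"
    and nonempty: "measure Q {\<omega> \<in> space Q. points \<omega> = {}} < 1"
  shows "emeasure Q Omega0 \<noteq> 0"
proof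
  interpret prob_space Q by fact
  have space_Q: "space Q = UNIV"
    using sets_eq_imp_space_eq[OF sets_Q] by simp
  have [measurable]: "(\<lambda>\<omega>. \<omega> x) \<in> Q \<rightarrow>\<^sub>M count_space UNIV" for x
    using measurable_config_coord by (simp add: measurable_cong_sets[OF sets_Q refl])
  have meas: "{\<omega>. \<omega> x} \<in> sets Q" for x
  proof -
    have "{\<omega> \<in> space Q. \<omega> x} \<in> sets Q" by measurable
    then show ?thesis by (simp add: space_Q)
  qed
  have T: "translate 1 \<in> Q \<rightarrow>\<^sub>M Q" and inv: "distr Q Q (translate 1) = Q"
    using st by (auto simp: stationary_def)
  have step: "emeasure Q {\<omega>. \<omega> x} = emeasure Q {\<omega>. \<omega> (x + 1)}" for x
  proof -
    have "emeasure Q {\<omega>. \<omega> x} = emeasure (distr Q Q (translate 1)) {\<omega>. \<omega> x}"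
      by (simp add: inv)
    also have "\<dots> = emeasure Q {\<omega>. \<omega> (x + 1)}"
      using T meas by (subst emeasure_distr) (auto simp: space_Q translate_def vimage_def add.commute)
    finally show ?thesis .
  qed
  assume "emeasure Q Omega0 = 0"
  then have null: "emeasure Q {\<omega>. \<omega> x} = 0" for x
  proof (induction x rule: int_induct[where k = 0])
    case base
    then show ?case by (simp add: Omega0_def)
  next
    case (step1 i)
    then show ?case using step[of i] by simp
  next
    case (step2 i)
    then show ?case using step[of "i - 1"] by simp
  qed
  have "AE \<omega> in Q. \<not> \<omega> x" for x
    using meas[of x] null[of x] by (intro AE_I[where N = "{\<omega>. \<omega> x}"]) auto
  then have "AE \<omega> in Q. points \<omega> = {}"
    unfolding points_def by (simp add: AE_all_countable)
  moreover have "{\<omega> \<in> space Q. points \<omega> = {}} \<in> sets Q"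
    unfolding points_def by simp
  ultimately have "prob {\<omega> \<in> space Q. points \<omega> = {}} = 1"
    by (simp add: prob_Collect_eq_1)
  with nonempty show False by simp
qed

lemma prob_space_palm:
  assumes "prob_space Q" "sets Q = sets config_space" "emeasure Q Omega0 \<noteq> 0"
  shows "prob_space (palm Q)"
  using assms unfolding palm_def
  by (intro prob_space_uniform_measure) (auto simp: prob_space.emeasure_space_1 prob_space.finite_measure
      finite_measure.emeasure_finite)

theorem emeasure_annealed:
  assumes "prob_space Q" "sets Q = sets config_space" "emeasure Q Omega0 \<noteq> 0"
    and "G \<in> sets path_space"
  shows "emeasure (annealed Q) G = (\<integral>\<^sup>+\<omega>. emeasure (quenched \<omega>) G \<partial>palm Q)"
  unfolding annealed_def using assms prob_space_palm[OF assms(1-3)]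
  by (intro emeasure_bind_prob_algebra[where N = config_space and L = path_space])
     (auto simp: space_prob_algebra palm_def)

theorem prob_space_annealed:
  assumes "prob_space Q" "sets Q = sets config_space" "emeasure Q Omega0 \<noteq> 0"
  shows "prob_space (annealed Q)" "sets (annealed Q) = sets path_space"
proof -
  have "palm Q \<in> space (prob_algebra config_space)"
    using prob_space_palm[OF assms] assms by (simp add: space_prob_algebra palm_def)
  then have "annealed Q \<in> space (prob_algebra path_space)"
    unfolding annealed_def
    by (rule measurable_space[OF measurable_bind_prob_space[OF measurable_ident measurable_quenched],
          unfolded id_def])
  then show "prob_space (annealed Q)" "sets (annealed Q) = sets path_space"
    by (auto simp: space_prob_algebra)
qed

end

theory Submission
  imports Defs
begin

text \<open>Stationarity rules out a last point in either direction: the events that \<open>x\<close> is the last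
  point are disjoint and equiprobable for different \<open>x\<close>. Hence, almost surely, the walk is a simple
  symmetric random walk on a bi-infinite sequence of points. The probability of never hitting 0 from
  the \<open>k\<close>-th point is bounded, vanishes at \<open>k = 0\<close> and is harmonic for \<open>k > 0\<close>; so it is linear
  in \<open>k\<close>, hence zero. Therefore no visit to 0 is the last one.\<close>

section \<open>Neighbouring points of a two-sided configuration\<close>

definition next_point :: "config \<Rightarrow> int \<Rightarrow> int \<Rightarrow> int" where
  "next_point \<omega> e v = v + int (first_point e (translate v \<omega>)) * e"

text \<open>Only the points of \<open>\<omega>\<close> are constrained, so the empty configuration
  qualifies; this is exactly what stationarity yields almost surely.\<close>

definition two_sided :: "config \<Rightarrow> bool" where
  "two_sided \<omega> \<longleftrightarrow> (\<forall>v. \<omega> v \<longrightarrow> (\<forall>e\<in>{1, -1}. \<exists>k>0. \<omega> (v + int k * e)))"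

lemma nbrs_next_point: "nbrs \<omega> v = {next_point \<omega> 1 v, next_point \<omega> (-1) v}"
  by (simp add: nbrs_def next_point_def)

lemma first_point_props:
  assumes "two_sided \<omega>" "\<omega> v" "e \<in> {1, -1}"
  shows "0 < first_point e (translate v \<omega>)" "\<omega> (next_point \<omega> e v)"
    and "\<And>k. 0 < k \<Longrightarrow> k < first_point e (translate v \<omega>) \<Longrightarrow> \<not> \<omega> (v + int k * e)"
proof -
  have ex: "\<exists>k>0. \<omega> (v + int k * e)"
    using assms unfolding two_sided_def by blast
  show "0 < first_point e (translate v \<omega>)" "\<omega> (next_point \<omega> e v)"
    using LeastI_ex[OF ex] by (simp_all add: first_point_def translate_def next_point_def)
  show "\<not> \<omega> (v + int k * e)" if "0 < k" "k < first_point e (translate v \<omega>)" for k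
    using not_less_Least[of k "\<lambda>k. 0 < k \<and> \<omega> (v + int k * e)"] that
    by (simp add: first_point_def translate_def)
qed

text \<open>No point lies strictly between \<open>v\<close> and the next one, so the search
  backwards stops at \<open>v\<close>. The walk thus moves between consecutive points and cannot
  jump over 0.\<close>

lemma next_point_back:
  assumes "two_sided \<omega>" "\<omega> v" "e \<in> {1, -1}"
  shows "next_point \<omega> (- e) (next_point \<omega> e v) = v"
proof -
  define k where "k = first_point e (translate v \<omega>)"
  note fp = first_point_props[OF assms, folded k_def]
  have "(LEAST j. 0 < j \<and> \<omega> (v + int k * e + int j * - e)) = k"
  proof (rule Least_equality)
    show "0 < k \<and> \<omega> (v + int k * e + int k * - e)"
      using fp(1) assms(2) by simp
    fix j assume j: "0 < j \<and> \<omega> (v + int k * e + int j * - e)"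
    show "k \<le> j"
    proof (rule ccontr)
      assume "\<not> k \<le> j"
      with j fp(3)[of "k - j"] show False
        by (simp add: of_nat_diff algebra_simps)
    qed
  qed
  then show ?thesis
    by (simp add: next_point_def first_point_def translate_def k_def)
qed

section \<open>Hitting 0: harmonicity along a half-line of points\<close>

text \<open>For a point \<open>v\<close> of a two-sided configuration this is the probability that
  the walk from \<open>v\<close> hits 0 within \<open>m\<close> steps, by conditioning on the first
  step. The finite horizon gives a recursion free of the path measure.\<close>

primrec hit_prob :: "config \<Rightarrow> nat \<Rightarrow> int \<Rightarrow> real" where
  "hit_prob \<omega> 0 v = (if v = 0 then 1 else 0)"
| "hit_prob \<omega> (Suc m) v = (if v = 0 then 1 else
     (hit_prob \<omega> m (next_point \<omega> 1 v) + hit_prob \<omega> m (next_point \<omega> (-1) v)) / 2)"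

lemma hit_prob_0 [simp]: "hit_prob \<omega> m 0 = 1"
  by (cases m) auto

lemma hit_prob_nonneg: "0 \<le> hit_prob \<omega> m v"
  by (induction m arbitrary: v) auto

lemma hit_prob_le_1: "hit_prob \<omega> m v \<le> 1"
proof (induction m arbitrary: v)
  case (Suc m)
  show ?case
    using Suc[of "next_point \<omega> 1 v"] Suc[of "next_point \<omega> (-1) v"] by simp
qed simp

lemma hit_prob_le_Suc: "hit_prob \<omega> m v \<le> hit_prob \<omega> (Suc m) v"
proof (induction m arbitrary: v)
  case 0
  show ?case by (auto simp: hit_prob_nonneg)
next
  case (Suc m)
  show ?case
    using Suc[of "next_point \<omega> 1 v"] Suc[of "next_point \<omega> (-1) v"]
    by (simp del: hit_prob.simps add: hit_prob.simps(2)[of _ "Suc m"] hit_prob.simps(2)[of _ m v])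
qed

text \<open>The recurrence makes the increments constant, so \<open>s\<close> is linear with slope
  \<open>s 1\<close>, and boundedness forces that slope to be zero.\<close>

lemma bounded_linear_recurrence_eq_0:
  fixes s :: "nat \<Rightarrow> real"
  assumes "s 0 = 0" "\<And>k. s (Suc k) = (s (Suc (Suc k)) + s k) / 2"
    and bdd: "\<And>k. \<bar>s k\<bar> \<le> B"
  shows "s k = 0"
proof -
  \<comment> \<open>Two consecutive values are carried along because the recurrence is of second
    order.\<close>
  have lin: "s k = real k * s 1 \<and> s (Suc k) = real (Suc k) * s 1" for k
  proof (induction k)
    case (Suc k)
    with assms(2)[of k] show ?case by (simp add: algebra_simps)
  qed (simp add: assms(1))
  have "s 1 = 0"
  proof (rule ccontr)
    assume "s 1 \<noteq> 0"
    then obtain n where "B < real n * \<bar>s 1\<bar>"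
      using reals_Archimedean3[of "\<bar>s 1\<bar>"] by auto
    moreover have "\<bar>s n\<bar> = real n * \<bar>s 1\<bar>"
      using lin[of n] by (simp add: abs_mult)
    ultimately show False using bdd[of n] by simp
  qed
  with lin[of k] show ?thesis by simp
qed

lemma hit_prob_neighbour_tendsto_1:
  assumes "two_sided \<omega>" "\<omega> 0" and e: "e \<in> {1, -1}"
  shows "(\<lambda>m. hit_prob \<omega> m (next_point \<omega> e 0)) \<longlonglongrightarrow> 1"
proof -
  \<comment> \<open>The chance of ever hitting 0, as the limit of a bounded monotone sequence in the
    horizon.\<close>
  define L where "L v = lim (\<lambda>m. hit_prob \<omega> m v)" for v
  have L: "(\<lambda>m. hit_prob \<omega> m v) \<longlonglongrightarrow> L v" for v
  proof -
    have "incseq (\<lambda>m. hit_prob \<omega> m v)"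
      by (intro incseq_SucI hit_prob_le_Suc)
    then have "convergent (\<lambda>m. hit_prob \<omega> m v)"
      by (rule incseq_convergent[where B = 1]) (auto simp: hit_prob_le_1 convergent_def)
    then show ?thesis
      by (simp add: L_def convergent_LIMSEQ_iff)
  qed
  have L_bounds: "0 \<le> L v" "L v \<le> 1" for v
    using LIMSEQ_le_const[OF L, of 0 v] LIMSEQ_le_const2[OF L, of v 1]
    by (auto simp: hit_prob_nonneg hit_prob_le_1)
  \<comment> \<open>The recursion passes to the limit; writing it with \<open>e\<close> and
    \<open>- e\<close> treats both sides of 0 at once.\<close>
  have L_harmonic: "L v = (L (next_point \<omega> e v) + L (next_point \<omega> (- e) v)) / 2" if "v \<noteq> 0" for v
  proof (rule LIMSEQ_unique[OF LIMSEQ_Suc[OF L]])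
    show "(\<lambda>m. hit_prob \<omega> (Suc m) v)
        \<longlonglongrightarrow> (L (next_point \<omega> e v) + L (next_point \<omega> (- e) v)) / 2"
      using e that by (auto intro!: tendsto_eq_intros L)
  qed
  define p where "p k = (next_point \<omega> e ^^ k) 0" for k
  have p_Suc: "p (Suc k) = next_point \<omega> e (p k)" for k
    by (simp add: p_def)
  \<comment> \<open>Each step advances by at least one in direction \<open>e\<close>, so
    \<open>p k\<close> stays away from 0 for positive \<open>k\<close>, where harmonicity
    applies.\<close>
  have p: "\<omega> (p k) \<and> int k \<le> p k * e" for k
  proof (induction k)
    case 0
    then show ?case using assms by (simp add: p_def)
  next
    case (Suc k)
    with first_point_props(1,2)[OF assms(1) _ e, of "p k"] e show ?case
      unfolding p_Suc by (auto simp: next_point_def)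
  qed
  have "p (Suc k) \<noteq> 0" for k
    using p[of "Suc k"] by auto
  moreover have "next_point \<omega> (- e) (p (Suc k)) = p k" for k
    unfolding p_Suc using p[of k] by (intro next_point_back assms) auto
  ultimately have rec: "L (p (Suc k)) = (L (p (Suc (Suc k))) + L (p k)) / 2" for k
    using L_harmonic[of "p (Suc k)"] by (simp add: p_Suc)
  have "1 - L (p 1) = 0"
  proof (rule bounded_linear_recurrence_eq_0[of "\<lambda>k. 1 - L (p k)" 1])
    show "1 - L (p 0) = 0"
      by (simp add: p_def L_def)
    show "1 - L (p (Suc k)) = (1 - L (p (Suc (Suc k))) + (1 - L (p k))) / 2" for k
      unfolding rec[of k] by (simp add: diff_divide_distrib add_divide_distrib)
    show "\<bar>1 - L (p k)\<bar> \<le> 1" for k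
      using L_bounds[of "p k"] by simp
  qed
  then show ?thesis
    using L[of "p 1"] by (simp add: p_def)
qed

section \<open>Returns to 0 under the quenched law\<close>

lemma measurable_path_coord [measurable]:
  "(\<lambda>X. X n) \<in> path_space \<rightarrow>\<^sub>M count_space UNIV"
  unfolding path_space_def by (rule measurable_component_singleton) simp

lemma sets_quenched_Collect:
  "Measurable.pred path_space P \<Longrightarrow> {X. P X} \<in> sets (quenched \<omega>)"
  by (simp add: pred_def path_space_def space_PiM)

text \<open>Histories are total functions of which only the values up to \<open>n\<close> matter, so
  a history is prolonged by updating it at \<open>Suc n\<close>.\<close>

lemma quenched_cylinder_Suc:
  assumes "two_sided \<omega>" "\<omega> (x n)" "e \<in> {1, -1}"
  shows "measure (quenched \<omega>) {X. \<forall>i\<le>Suc n. X i = (x(Suc n := next_point \<omega> e (x n))) i} =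
    measure (quenched \<omega>) {X. \<forall>i\<le>n. X i = x i} / 2"
proof -
  have "\<exists>k>0. \<omega> (x n + int k)" "\<exists>k>0. \<omega> (x n - int k)"
    using assms(1,2) by (auto simp: two_sided_def)
  then have "pmf (step_pmf \<omega> (x n)) (next_point \<omega> e (x n)) = 1 / 2"
    using assms(3) by (subst pmf_step) (auto simp: nbrs_next_point)
  moreover have "(\<Prod>i<n. ennreal (pmf (step_pmf \<omega> ((x(Suc n := v)) i)) ((x(Suc n := v)) (Suc i)))) =
      (\<Prod>i<n. ennreal (pmf (step_pmf \<omega> (x i)) (x (Suc i))))" for v
    by (intro prod.cong) auto
  ultimately show ?thesis
    by (simp add: measure_def emeasure_quenched_cylinder prod.lessThan_Suc enn2real_mult
        del: fun_upd_apply) (simp add: enn2real_mult)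
qed

text \<open>A Markov property in product form, which avoids dividing by the mass of the history. The
  induction generalises over the history, since each step prolongs it by one of two
  neighbours.\<close>

lemma quenched_hit_ge:
  assumes "two_sided \<omega>" "\<omega> (x n)"
  shows "measure (quenched \<omega>) {X. \<forall>i\<le>n. X i = x i} * hit_prob \<omega> m (x n) \<le>
    measure (quenched \<omega>) {X. (\<forall>i\<le>n. X i = x i) \<and> (\<exists>i\<ge>n. i \<le> n + m \<and> X i = 0)}"
  using assms(2)
proof (induction m arbitrary: n x)
  case 0
  show ?case
  proof (cases "x n = 0")
    case True
    then have "{X. (\<forall>i\<le>n. X i = x i) \<and> (\<exists>i\<ge>n. i \<le> n + 0 \<and> X i = 0)} = {X. \<forall>i\<le>n. X i = x i}"
      by auto
    with True show ?thesis by simp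
  qed simp
next
  case (Suc m)
  interpret prob_space "quenched \<omega>" by (rule prob_space_quenched)
  let ?H = "\<lambda>n x m. {X. (\<forall>i\<le>n. X i = x i) \<and> (\<exists>i\<ge>n. i \<le> n + m \<and> X i = 0)}"
  have sets: "?H n x m \<in> events" for n x m
    by (rule sets_quenched_Collect) measurable
  show ?case
  proof (cases "x n = 0")
    case True
    then have "?H n x (Suc m) = {X. \<forall>i\<le>n. X i = x i}" by auto
    with True show ?thesis by simp
  next
    case False
    define y where "y e = x(Suc n := next_point \<omega> e (x n))" for e
    have y: "y e (Suc n) = next_point \<omega> e (x n)" for e
      by (simp add: y_def)
    have ge: "prob {X. \<forall>i\<le>n. X i = x i} / 2 * hit_prob \<omega> m (next_point \<omega> e (x n))
        \<le> prob (?H (Suc n) (y e) m)" if "e \<in> {1, -1}" for e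
      using Suc.IH[of "y e" "Suc n"] first_point_props(2)[OF assms(1) Suc.prems that]
        quenched_cylinder_Suc[where x = x, OF assms(1) Suc.prems that]
      unfolding y by (simp only: y_def)
    \<comment> \<open>The two prolonged histories differ at time \<open>Suc n\<close>, so their
      events are disjoint and the probabilities add.\<close>
    have "next_point \<omega> 1 (x n) \<noteq> next_point \<omega> (-1) (x n)"
      using first_point_props(1)[OF assms(1) Suc.prems, of 1] by (simp add: next_point_def)
    then have disj: "?H (Suc n) (y 1) m \<inter> ?H (Suc n) (y (-1)) m = {}"
      unfolding y_def by fastforce
    have "prob {X. \<forall>i\<le>n. X i = x i} * hit_prob \<omega> (Suc m) (x n)
        \<le> prob (?H (Suc n) (y 1) m) + prob (?H (Suc n) (y (-1)) m)"
      using ge[of 1] ge[of "-1"] False by (simp add: algebra_simps add_divide_distrib)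
    also have "\<dots> = prob (?H (Suc n) (y 1) m \<union> ?H (Suc n) (y (-1)) m)"
      by (rule finite_measure_Union[symmetric]) (fact sets disj)+
    also have "\<dots> \<le> prob (?H n x (Suc m))"
    proof (rule finite_measure_mono[OF _ sets])
      have "?H (Suc n) (y e) m \<subseteq> ?H n x (Suc m)" for e
      proof
        fix X assume X: "X \<in> ?H (Suc n) (y e) m"
        then have "\<forall>i\<le>n. X i = x i"
          by (auto simp: y_def split: if_splits)
        moreover from X obtain i where "i \<ge> Suc n" "i \<le> Suc n + m" "X i = 0" by blast
        ultimately show "X \<in> ?H n x (Suc m)" by (auto intro!: exI[of _ i])
      qed
      then show "?H (Suc n) (y 1) m \<union> ?H (Suc n) (y (-1)) m \<subseteq> ?H n x (Suc m)" by blast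
    qed
    finally show ?thesis .
  qed
qed

text \<open>Each of the two prolongations carries half the mass of the history, and from either
  neighbour of 0 a return is certain in the limit. So the return event exhausts the
  cylinder.\<close>

lemma quenched_return:
  assumes "two_sided \<omega>" "\<omega> 0" "x n = 0"
  shows "AE X in quenched \<omega>. (\<forall>i\<le>n. X i = x i) \<longrightarrow> (\<exists>i>n. X i = 0)"
proof -
  interpret prob_space "quenched \<omega>" by (rule prob_space_quenched)
  let ?C = "\<lambda>n x. {X. \<forall>i\<le>n. X i = x i}"
  define y where "y e = x(Suc n := next_point \<omega> e (x n))" for e
  define R where "R = {X. (\<forall>i\<le>n. X i = x i) \<and> (\<exists>i>n. X i = 0)}"
  define R' where "R' e = {X. (\<forall>i\<le>Suc n. X i = y e i) \<and> (\<exists>i>n. X i = 0)}" for e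
  have sets_C: "?C n x \<in> events" and sets_R: "R \<in> events" and sets_R': "R' e \<in> events" for e
    unfolding R_def R'_def by (rule sets_quenched_Collect; measurable)+
  \<comment> \<open>The bound holds for every horizon \<open>m\<close>; letting \<open>m\<close>
    tend to infinity removes the hitting factor.\<close>
  have half: "prob (?C n x) / 2 \<le> prob (R' e)" if e: "e \<in> {1, -1}" for e
  proof (rule LIMSEQ_le_const2)
    show "(\<lambda>m. prob (?C n x) / 2 * hit_prob \<omega> m (next_point \<omega> e 0)) \<longlonglongrightarrow> prob (?C n x) / 2"
      using tendsto_mult_left[OF hit_prob_neighbour_tendsto_1[OF assms(1,2) e], of "prob (?C n x) / 2"] by simp
    have "prob (?C n x) / 2 * hit_prob \<omega> m (next_point \<omega> e 0) \<le> prob (R' e)" for m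
    proof -
      have "prob (?C n x) / 2 * hit_prob \<omega> m (next_point \<omega> e 0) =
          prob (?C (Suc n) (y e)) * hit_prob \<omega> m (y e (Suc n))"
        using quenched_cylinder_Suc[OF assms(1) _ e, of x n] assms(2,3) by (simp add: y_def)
      also have "\<dots> \<le> prob {X. (\<forall>i\<le>Suc n. X i = y e i) \<and> (\<exists>i\<ge>Suc n. i \<le> Suc n + m \<and> X i = 0)}"
        using first_point_props(2)[OF assms(1,2) e] assms(3)
        by (intro quenched_hit_ge assms(1)) (simp add: y_def)
      also have "\<dots> \<le> prob (R' e)"
        by (rule finite_measure_mono[OF _ sets_R']) (auto simp: R'_def Suc_le_eq)
      finally show ?thesis .
    qed
    then show "\<exists>N. \<forall>m\<ge>N. prob (?C n x) / 2 * hit_prob \<omega> m (next_point \<omega> e 0) \<le> prob (R' e)"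
      by blast
  qed
  have "next_point \<omega> 1 (x n) \<noteq> next_point \<omega> (-1) (x n)"
    using first_point_props(1)[OF assms(1,2), of 1] assms(3) by (simp add: next_point_def)
  then have disj: "R' 1 \<inter> R' (-1) = {}"
    unfolding R'_def y_def by fastforce
  have "prob (?C n x) \<le> prob (R' 1) + prob (R' (-1))"
    using half[of 1] half[of "-1"] by simp
  also have "\<dots> = prob (R' 1 \<union> R' (-1))"
    by (rule finite_measure_Union[symmetric]) (fact sets_R' disj)+
  also have "\<dots> \<le> prob R"
    by (rule finite_measure_mono[OF _ sets_R]) (auto simp: R_def R'_def y_def split: if_splits)
  finally have "prob (?C n x) \<le> prob R" .
  moreover have "R \<subseteq> ?C n x"
    by (auto simp: R_def)
  ultimately have "prob (?C n x - R) \<le> 0"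
    using finite_measure_Diff[OF sets_C sets_R] by simp
  then have "?C n x - R \<in> null_sets (quenched \<omega>)"
    using sets_C sets_R measure_nonneg[of "quenched \<omega>" "?C n x - R"]
    by (intro null_setsI) (auto simp: emeasure_eq_measure)
  then show ?thesis
    by (rule AE_I') (auto simp: R_def)
qed

lemma quenched_recurrent:
  assumes "two_sided \<omega>" "\<omega> 0"
  shows "AE X in quenched \<omega>. \<exists>\<^sub>\<infinity>n. X n = 0"
proof -
  interpret prob_space "quenched \<omega>" by (rule prob_space_quenched)
  have sets_0: "{X. X 0 = 0} \<in> events"
    by (rule sets_quenched_Collect) measurable
  have "prob {X. X 0 = 0} = 1"
    using emeasure_quenched_cylinder[of \<omega> 0 "\<lambda>_. 0"] by (simp add: measure_def)
  then have start: "AE X in quenched \<omega>. X 0 = 0"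
    using AE_prob_1[of "{X. X 0 = 0}"] by simp
  \<comment> \<open>Histories are coded as lists because there are only countably many of them.
    Values of \<open>xs ! i\<close> beyond the length do no harm, as the previous lemma allows any
    function.\<close>
  have "AE X in quenched \<omega>. \<forall>(xs :: int list) n. xs ! n = 0 \<longrightarrow>
      (\<forall>i\<le>n. X i = xs ! i) \<longrightarrow> (\<exists>i>n. X i = 0)"
    using quenched_return[OF assms] by (simp add: AE_all_countable)
  with start show ?thesis
  proof eventually_elim
    case (elim X)
    \<comment> \<open>The history is taken to be the initial segment of \<open>X\<close> itself, up
      to and including time \<open>n\<close>.\<close>
    have step: "\<exists>i>n. X i = 0" if "X n = 0" for n
      using elim(2)[rule_format, of "map X [0..<Suc n]" n] that
      by (simp del: upt_Suc)
    have "\<exists>n\<ge>m. X n = 0" for m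
    proof (induction m)
      case (Suc m)
      then obtain n where "n \<ge> m" "X n = 0" by blast
      with step[of n] show ?case by (meson Suc_leI le_less_trans)
    qed (use elim in auto)
    then show ?case
      by (simp add: INFM_nat_le)
  qed
qed

section \<open>Stationarity and passage to the annealed law\<close>

lemma stationary_no_last_point:
  assumes "prob_space Q" and sets_Q: "sets Q = sets config_space"
    and st: "stationary Q (translate 1)" and e: "e \<in> {1, -1}"
  shows "AE \<omega> in Q. \<omega> v \<longrightarrow> (\<exists>k>0. \<omega> (v + int k * e))"
proof -
  interpret prob_space Q by fact
  have space_Q: "space Q = UNIV"
    using sets_eq_imp_space_eq[OF sets_Q] by simp
  have [measurable]: "(\<lambda>\<omega>. \<omega> x) \<in> Q \<rightarrow>\<^sub>M count_space UNIV" for x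
    using measurable_config_coord by (simp add: measurable_cong_sets[OF sets_Q refl])
  define A where "A x = {\<omega>. \<omega> x \<and> (\<forall>k>0. \<not> \<omega> (x + int k * e))}" for x
  have sets_A: "A x \<in> events" for x
  proof -
    have "{\<omega> \<in> space Q. \<omega> x \<and> (\<forall>k>0. \<not> \<omega> (x + int k * e))} \<in> events" by measurable
    then show ?thesis by (simp add: space_Q A_def)
  qed
  have T: "translate 1 \<in> Q \<rightarrow>\<^sub>M Q" and inv: "distr Q Q (translate 1) = Q"
    using st by (auto simp: stationary_def)
  \<comment> \<open>The preimage of \<open>A x\<close> under the shift is
    \<open>A (x + 1)\<close>.\<close>
  have shift: "prob (A (x + 1)) = prob (A x)" for x
  proof -
    have "prob (A x) = measure (distr Q Q (translate 1)) (A x)"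
      by (simp add: inv)
    also have "\<dots> = prob (A (x + 1))"
      using T sets_A by (subst measure_distr)
        (auto simp: space_Q A_def translate_def vimage_def add_ac)
    finally show ?thesis by simp
  qed
  have const: "prob (A (v + int n)) = prob (A v)" for n
  proof (induction n)
    case (Suc n)
    with shift[of "v + int n"] show ?case by (simp add: add_ac)
  qed simp
  \<comment> \<open>For \<open>e = 1\<close> the point \<open>y\<close> lies ahead of
    \<open>x\<close>, for \<open>e = -1\<close> the point \<open>x\<close> lies ahead of
    \<open>y\<close>; the distance \<open>y - x\<close> is the witness in both cases.\<close>
  have disj: "A x \<inter> A y = {}" if less: "x < y" for x y
  proof -
    from e consider "e = 1" | "e = -1" by auto
    then show ?thesis
    proof cases
      case 1
      with less show ?thesis by (auto simp: A_def dest!: spec[of _ "nat (y - x)"])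
    next
      case 2
      with less show ?thesis by (auto simp: A_def dest!: spec[of _ "nat (y - x)"])
    qed
  qed
  have "disjoint_family (\<lambda>n. A (v + int n))"
    unfolding disjoint_family_on_def
  proof (intro ballI impI)
    fix m n :: nat assume "m \<noteq> n"
    then show "A (v + int m) \<inter> A (v + int n) = {}"
      using disj[of "v + int m" "v + int n"] disj[of "v + int n" "v + int m"]
      by (cases "m < n") auto
  qed
  then have "(\<lambda>n. prob (A (v + int n))) sums prob (\<Union>n. A (v + int n))"
    using sets_A by (intro finite_measure_UNION) auto
  then have "summable (\<lambda>n. prob (A (v + int n)))"
    by (rule sums_summable)
  \<comment> \<open>The terms of the convergent series are constant and tend to zero.\<close>
  then have "prob (A v) = 0"
    using summable_LIMSEQ_zero by (fastforce simp: const LIMSEQ_const_iff)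
  then have "A v \<in> null_sets Q"
    using sets_A by (intro null_setsI) (auto simp: emeasure_eq_measure)
  then show ?thesis
    by (rule AE_I') (fastforce simp: A_def)
qed

theorem proposition1p10:
  fixes Q :: "config measure"
  assumes "prob_space Q" and "sets Q = sets config_space"
    and "stationary Q (translate 1)" and "ergodic Q (translate 1)"
    and "measure Q {\<omega> \<in> space Q. points \<omega> = {}} < 1"
  shows "AE X in annealed Q. \<exists>\<^sub>\<infinity>n. X n = 0"
proof -
  interpret prob_space Q by fact
  have two_sided: "AE \<omega> in Q. two_sided \<omega>"
    using stationary_no_last_point[OF assms(1-3), of 1] stationary_no_last_point[OF assms(1-3), of "-1"]
    by (simp add: two_sided_def AE_all_countable imp_conjR)
  have "Measurable.pred config_space (\<lambda>\<omega>. \<omega> 0)" by measurable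
  then have Omega0: "Omega0 \<in> events"
    by (simp add: assms(2) pred_def Omega0_def)
  \<comment> \<open>Conditioning on \<open>Omega0\<close> preserves null sets and puts a point at
    the origin, where the walk starts.\<close>
  have "AE \<omega> in palm Q. two_sided \<omega> \<and> \<omega> 0"
    unfolding palm_def using two_sided
    by (intro AE_uniform_measureI[OF Omega0]) (auto simp: Omega0_def)
  then have "AE \<omega> in palm Q. AE X in quenched \<omega>. \<exists>\<^sub>\<infinity>n. X n = 0"
    by eventually_elim (auto intro: quenched_recurrent)
  moreover have "quenched \<in> palm Q \<rightarrow>\<^sub>M subprob_algebra path_space"
    using measurable_prob_algebraD[OF measurable_quenched] assms(2)
    by (subst measurable_cong_sets[of _ config_space]) (simp_all add: palm_def)
  \<comment> \<open>Rewritten with countable quantifiers over times, the recurrence event is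
    measurable.\<close>
  moreover have "Measurable.pred path_space (\<lambda>X. \<exists>\<^sub>\<infinity>n. X n = 0)"
    unfolding INFM_nat_le by measurable
  ultimately show ?thesis
    unfolding annealed_def by (simp add: AE_bind)
qed

end
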